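(* Let $k,l,n\in\mathbb{N}$, $a_i,d_i\in\mathbb{N}$, $b_i,e_i\in\mathbb{N}_0$, $c_i,f_i\in\mathbb{Z}\setminus\{0\}$. Write $A(i)=S_{(a_1,b_1,c_1),\dots,(a_k,b_k,c_k)}(i)$, $\bar A(i)=S_{(a_2,b_2,c_2),\dots,(a_k,b_k,c_k)}(i)$, $D(i)=S_{(d_1,e_1,f_1),\dots,(d_l,e_l,f_l)}(i)$, $\bar D(i)=S_{(d_2,e_2,f_2),\dots,(d_l,e_l,f_l)}(i)$ and $s=\mathrm{sign}(c_1)\,\mathrm{sign}(f_1)$. If $a_1e_1\ne d_1b_1$, then $$\begin{aligned}A(n)D(n)=&\sum_{i=1}^n\frac{\mathrm{sign}(c_1)^i}{(a_1i+b_1)^{|c_1|}}\bar A(i)D(i)+\sum_{i=1}^n\frac{\mathrm{sign}(f_1)^i}{(d_1i+e_1)^{|f_1|}}A(i)\bar D(i)\\&-\sum_{i=1}^n s^i\Bigg((-1)^{|c_1|}\sum_{j=1}^{|c_1|}(-1)^j\binom{|c_1|+|f_1|-j-1}{|f_1|-1}\frac{a_1^{|f_1|}d_1^{|c_1|-j}}{(a_1e_1-d_1b_1)^{|c_1|+|f_1|-j}}\frac{1}{(a_1i+b_1)^j}\\&\qquad+(-1)^{|f_1|}\sum_{j=1}^{|f_1|}(-1)^j\binom{|c_1|+|f_1|-j-1}{|c_1|-1}\frac{a_1^{|f_1|-j}d_1^{|c_1|}}{(d_1b_1-a_1e_1)^{|c_1|+|f_1|-j}}\frac{1}{(d_1i+e_1)^j}\Bigg)\bar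 A(i)\bar D(i).\end{aligned}$$ If $a_1e_1=d_1b_1$, then $$\begin{aligned}A(n)D(n)=&\sum_{i=1}^n\frac{\mathrm{sign}(c_1)^i}{(a_1i+b_1)^{|c_1|}}\bar A(i)D(i)+\sum_{i=1}^n\frac{\mathrm{sign}(f_1)^i}{(d_1i+e_1)^{|f_1|}}A(i)\bar D(i)\\&-\left(\frac{a_1}{d_1}\right)^{|f_1|}\sum_{i=1}^n\frac{s^i}{(a_1i+b_1)^{|c_1|+|f_1|}}\bar A(i)\bar D(i).\end{aligned}$$
   Context: Cyclotomic harmonic sums: for $a_i\in\mathbb{N}=\{1,2,\dots\}$, $b_i\in\mathbb{N}_0$, $c_i\in\mathbb{Z}\setminus\{0\}$, $n\in\mathbb{N}_0$, $$S_{(a_1,b_1,c_1),\dots,(a_k,b_k,c_k)}(n)=\sum_{n\ge i_1\ge i_2\ge\cdots\ge i_k\ge1}\frac{\mathrm{sign}(c_1)^{i_1}}{(a_1i_1+b_1)^{|c_1|}}\cdots\frac{\mathrm{sign}(c_k)^{i_k}}{(a_ki_k+b_k)^{|c_k|}},$$ and the sum with empty index list equals $1$. *)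

theory Defs
  imports Complex_Main
begin

text \<open>The index list \<open>(a\<^sub>1,b\<^sub>1,c\<^sub>1),\<dots>,(a\<^sub>k,b\<^sub>k,c\<^sub>k)\<close> is a list of triples, and the summation
  runs over all lists \<open>[i\<^sub>1,\<dots>,i\<^sub>k]\<close> with \<open>n \<ge> i\<^sub>1 \<ge> \<dots> \<ge> i\<^sub>k \<ge> 1\<close>. Lists are accessed with
  indices starting from 0. For the empty index list, the only summation list is \<open>[]\<close> and the
  product is empty, so the sum is 1.\<close>

definition decreasing_indices :: "nat \<Rightarrow> nat \<Rightarrow> nat list set" where
  "decreasing_indices k n =
     {is. length is = k \<and> sorted_wrt (\<ge>) is \<and> set is \<subseteq> {1..n}}"

fun cyc_term :: "nat \<times> nat \<times> int \<Rightarrow> nat \<Rightarrow> real" where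
  "cyc_term (a, b, c) i = of_int (sgn c) ^ i / (of_nat (a * i + b)) ^ nat \<bar>c\<bar>"

definition cyc_harmonic_sum :: "(nat \<times> nat \<times> int) list \<Rightarrow> nat \<Rightarrow> real" where
  "cyc_harmonic_sum ps n =
     (\<Sum>is \<in> decreasing_indices (length ps) n. \<Prod>m<length ps. cyc_term (ps ! m) (is ! m))"

end

theory Submission
  imports Defs
begin

text \<open>A nested sum has increment \<open>A(i) - A(i-1) = t(i) A'(i)\<close>, where \<open>t\<close> is its outermost summand.
  So \<open>A D\<close> telescopes by the discrete product rule
  \<open>A(i) D(i) - A(i-1) D(i-1) = t A' D + A u D' - t u A' D'\<close>, and \<open>t u\<close> is
  split into partial fractions if the two linear factors are not proportional. Otherwise
  \<open>t u\<close> already is a multiple of a power of one factor.\<close>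

lemma finite_decreasing_indices: "finite (decreasing_indices k n)"
proof (rule finite_subset)
  show "decreasing_indices k n \<subseteq> {is. set is \<subseteq> {1..n} \<and> length is = k}"
    by (auto simp: decreasing_indices_def)
qed (simp add: finite_lists_length_eq)

text \<open>The head of a weakly decreasing list bounds all later entries, so once the head is
  \<open>i\<close>, the tail ranges over the same kind of lists with upper limit
  \<open>i\<close>.\<close>

lemma decreasing_indices_Suc:
  "decreasing_indices (Suc k) n =
     (\<lambda>(i, is). i # is) ` (SIGMA i:{1..n}. decreasing_indices k i)"
  (is "?L = ?f ` ?S")
proof
  show "?L \<subseteq> ?f ` ?S"
  proof
    fix xs assume xs: "xs \<in> ?L"
    then obtain i js where [simp]: "xs = i # js"
      by (cases xs) (auto simp: decreasing_indices_def)
    have "(i, js) \<in> ?S"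
      using xs by (force simp: decreasing_indices_def)
    then show "xs \<in> ?f ` ?S" by force
  qed
  show "?f ` ?S \<subseteq> ?L"
    by (force simp: decreasing_indices_def)
qed

text \<open>This recursion makes a nested sum an ordinary sum over its outermost index; the main
  proof uses no other property of nested sums.\<close>

lemma cyc_harmonic_sum_Cons:
  "cyc_harmonic_sum (t # ts) n = (\<Sum>i=1..n. cyc_term t i * cyc_harmonic_sum ts i)"
proof -
  have inj: "inj_on (\<lambda>(i, is). i # is) (SIGMA i:{1..n}. decreasing_indices (length ts) i)"
    by (auto simp: inj_on_def)
  have "cyc_harmonic_sum (t # ts) n =
      (\<Sum>(i, is)\<in>(SIGMA i:{1..n}. decreasing_indices (length ts) i).
        cyc_term t i * (\<Prod>m<length ts. cyc_term (ts ! m) (is ! m)))"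
    by (simp only: cyc_harmonic_sum_def length_Cons decreasing_indices_Suc sum.reindex[OF inj])
       (simp add: case_prod_unfold prod.lessThan_Suc_shift del: prod.lessThan_Suc)
  also have "\<dots> = (\<Sum>i=1..n. cyc_term t i * cyc_harmonic_sum ts i)"
    by (simp add: sum.Sigma[symmetric] finite_decreasing_indices cyc_harmonic_sum_def
        sum_distrib_left)
  finally show ?thesis .
qed

text \<open>The square of index pairs is covered by its two closed triangles, which overlap exactly
  in the diagonal.\<close>

lemma sum_mult_sum_diagonal:
  fixes g h :: "nat \<Rightarrow> 'a::comm_ring_1"
  shows "(\<Sum>i=1..n. g i) * (\<Sum>i=1..n. h i) =
    (\<Sum>i=1..n. g i * (\<Sum>j=1..i. h j)) + (\<Sum>i=1..n. h i * (\<Sum>j=1..i. g j)) - (\<Sum>i=1..n. g i * h i)"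
  by (induction n) (simp_all add: algebra_simps)

text \<open>The \<open>x\<close>-part of the partial fraction expansion of \<open>1 / (x ^ p * (x + w) ^ q)\<close>. The sum runs over
  \<open>m = p - j\<close>, so that the truncated \<open>q + m - 1\<close> gives the right value \<open>1 / x ^ p\<close> for \<open>q = 0 < p\<close>.\<close>

definition pole_part :: "'a::field \<Rightarrow> 'a \<Rightarrow> nat \<Rightarrow> nat \<Rightarrow> 'a" where
  "pole_part x w p q =
     (\<Sum>m<p. (-1) ^ m * of_nat ((q + m - 1) choose m) / (w ^ (q + m) * x ^ (p - m)))"

lemma pole_part_0_left [simp]: "pole_part x w 0 q = 0"
  by (simp add: pole_part_def)

text \<open>For \<open>m > 0\<close> the coefficient \<open>(m - 1) choose m\<close> vanishes, which
  leaves only \<open>m = 0\<close>.\<close>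

lemma pole_part_0_right: "pole_part x w (Suc p) 0 = 1 / x ^ Suc p"
  by (simp add: pole_part_def sum.lessThan_Suc_shift binomial_eq_0 del: sum.lessThan_Suc power_Suc)

text \<open>Writing \<open>w = (x + w) - x\<close> as a numerator over
  \<open>x ^ Suc p * (x + w) ^ Suc q\<close> cancels one factor in each term; this is the matching
  recurrence for the parts at the pole \<open>x = 0\<close>.\<close>

lemma pole_part_Suc_Suc:
  assumes "w \<noteq> 0"
  shows "w * pole_part x w (Suc p) (Suc q) = pole_part x w (Suc p) q - pole_part x w p (Suc q)"
proof -
  define r where "r m = (-1) ^ m / (w ^ (q + m) * x ^ (Suc p - m))" for m
  have "w * pole_part x w (Suc p) (Suc q) = (\<Sum>m<Suc p. of_nat ((q + m) choose m) * r m)"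
    using assms by (simp add: pole_part_def r_def sum_distrib_left field_simps del: sum.lessThan_Suc)
  \<comment> \<open>Pascal's rule for every \<open>m > 0\<close>, with the second summand shifted by
    one; at \<open>m = 0\<close> both coefficients are 1, also if \<open>q = 0\<close>.\<close>
  also have "\<dots> = (\<Sum>m<Suc p. of_nat ((q + m - 1) choose m) * r m)
      + (\<Sum>m<p. of_nat ((q + m) choose m) * r (Suc m))"
    by (simp add: sum.lessThan_Suc_shift distrib_right sum.distrib
        del: sum.lessThan_Suc)
  also have "(\<Sum>m<Suc p. of_nat ((q + m - 1) choose m) * r m) = pole_part x w (Suc p) q"
    by (simp add: pole_part_def r_def mult.commute del: sum.lessThan_Suc)
  also have "(\<Sum>m<p. of_nat ((q + m) choose m) * r (Suc m)) = - pole_part x w p (Suc q)"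
    by (simp add: pole_part_def r_def sum_negf[symmetric] mult.commute)
  finally show ?thesis by simp
qed

text \<open>Both sides obey the recurrence obtained by multiplying with \<open>y - x\<close>, which
  lowers one exponent at a time. The case \<open>p = q = 0\<close> is excluded because there the
  left side is 1 and both pole parts are empty.\<close>

lemma partial_fraction_powers:
  fixes x y :: "'a::field"
  assumes "x \<noteq> 0" "y \<noteq> 0" "x \<noteq> y" "0 < p + q"
  shows "1 / (x ^ p * y ^ q) = pole_part x (y - x) p q + pole_part y (x - y) q p"
  using assms(4)
proof (induction "p + q" arbitrary: p q rule: less_induct)
  case less
  show ?case
  proof (cases "p = 0 \<or> q = 0")
    case True
    then show ?thesis
      using less.prems by (cases p; cases q) (auto simp: pole_part_0_right)
  next
    case False
    then obtain p' q' where [simp]: "p = Suc p'" "q = Suc q'"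
      by (metis not0_implies_Suc)
    have "(y - x) * (1 / (x ^ p * y ^ q)) = 1 / (x ^ p * y ^ q') - 1 / (x ^ p' * y ^ q)"
      using assms by (simp add: field_simps)
    also have "1 / (x ^ p * y ^ q') = pole_part x (y - x) p q' + pole_part y (x - y) q' p"
      by (rule less.hyps) auto
    also have "1 / (x ^ p' * y ^ q) = pole_part x (y - x) p' q + pole_part y (x - y) q p'"
      by (rule less.hyps) auto
    \<comment> \<open>The recurrence is used once per pole; the roles of \<open>x\<close> and
      \<open>y\<close> are swapped in the second use, hence the opposite sign.\<close>
    also have "pole_part x (y - x) p q' + pole_part y (x - y) q' p
        - (pole_part x (y - x) p' q + pole_part y (x - y) q p')
        = (y - x) * pole_part x (y - x) p q - (x - y) * pole_part y (x - y) q p"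
      using assms by (simp add: pole_part_Suc_Suc)
    also have "\<dots> = (y - x) * (pole_part x (y - x) p q + pole_part y (x - y) q p)"
      by (simp add: algebra_simps)
    finally have "(y - x) * (1 / (x ^ p * y ^ q)) = \<dots>" .
    moreover have "y - x \<noteq> 0"
      using assms by simp
    ultimately show ?thesis
      using mult_left_cancel by blast
  qed
qed

text \<open>Substituting \<open>j = p - m\<close> and cancelling \<open>v ^ j\<close> turns a pole
  part into the form of the sums over \<open>j\<close> in the theorem.\<close>

lemma pole_part_scaled:
  fixes x w u v :: "'a::field"
  assumes "v \<noteq> 0" "0 < q"
  shows "u ^ q * v ^ p * pole_part (v * x) w p q =
    (-1) ^ p * (\<Sum>j=1..p. (-1) ^ j * of_nat ((p + q - j - 1) choose (q - 1))
      * (u ^ q * v ^ (p - j) / w ^ (p + q - j)) * (1 / x ^ j))"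
proof -
  have "u ^ q * v ^ p * pole_part (v * x) w p q =
      (\<Sum>j=1..p. u ^ q * v ^ p * ((-1) ^ (p - j) * of_nat ((q + (p - j) - 1) choose (p - j))
        / (w ^ (q + (p - j)) * (v * x) ^ (p - (p - j)))))"
    unfolding pole_part_def sum_distrib_left
    by (rule sum.reindex_bij_witness[of _ "\<lambda>j. p - j" "\<lambda>m. p - m"]) auto
  also have "\<dots> = (\<Sum>j=1..p. (-1) ^ p * ((-1) ^ j * of_nat ((p + q - j - 1) choose (q - 1))
      * (u ^ q * v ^ (p - j) / w ^ (p + q - j)) * (1 / x ^ j)))"
  proof (rule sum.cong[OF refl])
    fix j assume "j \<in> {1..p}"
    then obtain m where [simp]: "p = m + j"
      by (metis atLeastAtMost_iff le_add_diff_inverse2)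
    \<comment> \<open>Since \<open>0 < q\<close>, the lower indices \<open>m\<close> and
      \<open>q - 1\<close> really add up to \<open>q + m - 1\<close>.\<close>
    have "(q + m - 1) choose m = (q + m - 1) choose (q - 1)"
      using assms(2) by (subst binomial_symmetric) auto
    then show "u ^ q * v ^ p * ((-1) ^ (p - j) * of_nat ((q + (p - j) - 1) choose (p - j))
        / (w ^ (q + (p - j)) * (v * x) ^ (p - (p - j)))) =
      (-1) ^ p * ((-1) ^ j * of_nat ((p + q - j - 1) choose (q - 1))
      * (u ^ q * v ^ (p - j) / w ^ (p + q - j)) * (1 / x ^ j))"
      using assms(1)
      by (simp add: power_add power_mult_distrib mult_ac add.commute)
  qed
  finally show ?thesis by (simp only: sum_distrib_left)
qed

text \<open>The factors are rescaled to \<open>v * x\<close> and \<open>u * y\<close>. For linear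
  \<open>x\<close> and \<open>y\<close> in \<open>i\<close> with leading coefficients
  \<open>u\<close> and \<open>v\<close>, these have equal slope, so their difference
  \<open>w\<close> does not depend on \<open>i\<close>.\<close>

lemma partial_fraction_linear:
  fixes x y u v :: "'a::field"
  assumes "x \<noteq> 0" "y \<noteq> 0" "u \<noteq> 0" "v \<noteq> 0" "w = u * y - v * x" "w' = v * x - u * y" "w \<noteq> 0"
    and "0 < p" "0 < q"
  shows "1 / (x ^ p * y ^ q) =
    (-1) ^ p * (\<Sum>j=1..p. (-1) ^ j * of_nat ((p + q - j - 1) choose (q - 1))
      * (u ^ q * v ^ (p - j) / w ^ (p + q - j)) * (1 / x ^ j))
    + (-1) ^ q * (\<Sum>j=1..q. (-1) ^ j * of_nat ((p + q - j - 1) choose (p - 1))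
      * (u ^ (q - j) * v ^ p / w' ^ (p + q - j)) * (1 / y ^ j))"
proof -
  have "1 / (x ^ p * y ^ q) = u ^ q * v ^ p * (1 / ((v * x) ^ p * (u * y) ^ q))"
    using assms by (simp add: power_mult_distrib)
  also have "\<dots> = u ^ q * v ^ p * pole_part (v * x) w p q + v ^ p * u ^ q * pole_part (u * y) w' q p"
    unfolding assms(5,6) using assms by (subst partial_fraction_powers) (auto simp: distrib_left mult_ac)
  finally show ?thesis
    unfolding pole_part_scaled[OF assms(4,9)] pole_part_scaled[OF assms(3,8)]
    by (simp only: add.commute[of q p] mult.commute[of "v ^ p" "u ^ _"])
qed

theorem theorem4p1p3:
  fixes k l n :: nat
    and a b d e :: "nat \<Rightarrow> nat"
    and c f :: "nat \<Rightarrow> int"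
    and A A' D D' :: "nat \<Rightarrow> real"
    and s :: real
    and p q :: nat
  assumes "k \<ge> 1" and "l \<ge> 1" and "n \<ge> 1"
    and "\<And>i. i \<in> {1..k} \<Longrightarrow> a i \<ge> 1 \<and> c i \<noteq> 0"
    and "\<And>i. i \<in> {1..l} \<Longrightarrow> d i \<ge> 1 \<and> f i \<noteq> 0"
  defines "A \<equiv> cyc_harmonic_sum (map (\<lambda>m. (a m, b m, c m)) [1..<k+1])"
    and "A' \<equiv> cyc_harmonic_sum (map (\<lambda>m. (a m, b m, c m)) [2..<k+1])"
    and "D \<equiv> cyc_harmonic_sum (map (\<lambda>m. (d m, e m, f m)) [1..<l+1])"
    and "D' \<equiv> cyc_harmonic_sum (map (\<lambda>m. (d m, e m, f m)) [2..<l+1])"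
    and "s \<equiv> real_of_int (sgn (c 1)) * real_of_int (sgn (f 1))"
    and "p \<equiv> nat \<bar>c 1\<bar>"
    and "q \<equiv> nat \<bar>f 1\<bar>"
  shows "(a 1 * e 1 \<noteq> d 1 * b 1 \<longrightarrow>
      A n * D n =
        (\<Sum>i=1..n. real_of_int (sgn (c 1)) ^ i / (real (a 1) * real i + real (b 1)) ^ p * A' i * D i)
      + (\<Sum>i=1..n. real_of_int (sgn (f 1)) ^ i / (real (d 1) * real i + real (e 1)) ^ q * A i * D' i)
      - (\<Sum>i=1..n. s ^ i *
          ((-1) ^ p *
             (\<Sum>j=1..p. (-1) ^ j * real ((p + q - j - 1) choose (q - 1))
                * (real (a 1) ^ q * real (d 1) ^ (p - j)
                   / (real (a 1) * real (e 1) - real (d 1) * real (b 1)) ^ (p + q - j))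
                * (1 / (real (a 1) * real i + real (b 1)) ^ j))
         + (-1) ^ q *
             (\<Sum>j=1..q. (-1) ^ j * real ((p + q - j - 1) choose (p - 1))
                * (real (a 1) ^ (q - j) * real (d 1) ^ p
                   / (real (d 1) * real (b 1) - real (a 1) * real (e 1)) ^ (p + q - j))
                * (1 / (real (d 1) * real i + real (e 1)) ^ j)))
         * A' i * D' i))
    \<and> (a 1 * e 1 = d 1 * b 1 \<longrightarrow>
      A n * D n =
        (\<Sum>i=1..n. real_of_int (sgn (c 1)) ^ i / (real (a 1) * real i + real (b 1)) ^ p * A' i * D i)
      + (\<Sum>i=1..n. real_of_int (sgn (f 1)) ^ i / (real (d 1) * real i + real (e 1)) ^ q * A i * D' i)
      - (real (a 1) / real (d 1)) ^ q *
          (\<Sum>i=1..n. s ^ i / (real (a 1) * real i + real (b 1)) ^ (p + q) * A' i * D' i))"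
proof -
  define t where "t i = real_of_int (sgn (c 1)) ^ i / (real (a 1) * real i + real (b 1)) ^ p" for i
  define u where "u i = real_of_int (sgn (f 1)) ^ i / (real (d 1) * real i + real (e 1)) ^ q" for i
  have a1: "a 1 \<ge> 1" and d1: "d 1 \<ge> 1" and p: "p > 0" and q: "q > 0"
    using assms(1,2,4,5) by (auto simp: p_def q_def)
  have upt: "[1..<m + 1] = 1 # [2..<m + 1]" if "m \<ge> 1" for m
    using that by (simp add: upt_conv_Cons numeral_2_eq_2)
  have A: "A m = (\<Sum>i=1..m. t i * A' i)" for m
    unfolding A_def upt[OF assms(1)] list.map cyc_harmonic_sum_Cons
    by (simp add: A'_def t_def p_def)
  have D: "D m = (\<Sum>i=1..m. u i * D' i)" for m
    unfolding D_def upt[OF assms(2)] list.map cyc_harmonic_sum_Cons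
    by (simp add: D'_def u_def q_def)
  have product: "A n * D n = (\<Sum>i=1..n. t i * A' i * D i) + (\<Sum>i=1..n. u i * A i * D' i)
      - (\<Sum>i=1..n. t i * u i * A' i * D' i)"
    unfolding A D sum_mult_sum_diagonal by (simp add: mult_ac)
  have tu: "t i * u i = s ^ i * (1 / ((real (a 1) * real i + real (b 1)) ^ p
      * (real (d 1) * real i + real (e 1)) ^ q))" for i
    by (simp add: t_def u_def s_def power_mult_distrib)
  \<comment> \<open>Summation starts at \<open>i = 1\<close>, so no denominator vanishes even when
    \<open>b 1\<close> or \<open>e 1\<close> is 0.\<close>
  have pos: "real (a 1) * real i + real (b 1) > 0" "real (d 1) * real i + real (e 1) > 0"
    if "i \<in> {1..n}" for i
    using that a1 d1 by (auto intro!: add_pos_nonneg)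
  show ?thesis
  proof (intro conjI impI, goal_cases)
    case 1
    then have w: "real (a 1) * real (e 1) - real (d 1) * real (b 1) \<noteq> 0"
      by (metis eq_iff_diff_eq_0 of_nat_eq_iff of_nat_mult)
    have "t i * u i = s ^ i *
        ((-1) ^ p *
           (\<Sum>j=1..p. (-1) ^ j * real ((p + q - j - 1) choose (q - 1))
              * (real (a 1) ^ q * real (d 1) ^ (p - j)
                 / (real (a 1) * real (e 1) - real (d 1) * real (b 1)) ^ (p + q - j))
              * (1 / (real (a 1) * real i + real (b 1)) ^ j))
       + (-1) ^ q *
           (\<Sum>j=1..q. (-1) ^ j * real ((p + q - j - 1) choose (p - 1))
              * (real (a 1) ^ (q - j) * real (d 1) ^ p
                 / (real (d 1) * real (b 1) - real (a 1) * real (e 1)) ^ (p + q - j))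
              * (1 / (real (d 1) * real i + real (e 1)) ^ j)))"
      if i: "i \<in> {1..n}" for i
      unfolding tu using pos[OF i] a1 d1 w p q
      \<comment> \<open>Here \<open>u\<close> is \<open>a 1\<close> and \<open>v\<close> is
        \<open>d 1\<close>; the terms with \<open>i\<close> cancel in \<open>w\<close>, leaving the
        determinant of the two linear factors.\<close>
      by (intro arg_cong[where f = "(*) (s ^ i)"], intro partial_fraction_linear)
         (simp_all add: algebra_simps)
    then show ?case
      unfolding product t_def[symmetric] u_def[symmetric]
      by (intro arg_cong2[where f = minus] refl sum.cong) (simp only:)
  next
    case 2
    have "t i * u i = (real (a 1) / real (d 1)) ^ q *
        (s ^ i / (real (a 1) * real i + real (b 1)) ^ (p + q))" if i: "i \<in> {1..n}" for i
    proof -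
      have "real (a 1) * real (e 1) = real (d 1) * real (b 1)"
        using 2 by (metis of_nat_mult)
      \<comment> \<open>The factors are proportional, and the \<open>q\<close>-th power of the
        inverted ratio is the constant in front of the last sum.\<close>
      then have "real (d 1) * real i + real (e 1)
          = real (d 1) / real (a 1) * (real (a 1) * real i + real (b 1))"
        using a1 by (simp add: field_simps)
      then show ?thesis
        unfolding tu by (simp add: power_mult_distrib power_divide power_add mult_ac)
    qed
    then show ?case
      unfolding product t_def[symmetric] u_def[symmetric]
      by (simp add: sum_distrib_left mult.assoc)
  qed
qed

end
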